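(* Let $(x_j)_{j\in J}$ be a Parseval frame for a real Hilbert space $H$, let $\lambda>0$ and $C>0$. Let $x\in H$ and suppose that $(x_j)_{j\in J}$ does $C$-stable $\lambda$-saturation recovery on $2\|x\|B_H$. If $(y_k)_{k=0}^\infty\subseteq H$ is constructed by the $\lambda$-saturated frame algorithm with $\alpha_k=\beta_k=1$ for all $k\ge 0$, then $\|x-y_{k+1}\|^2\le(1-C^{-2})\|x-y_k\|^2$ for all $k\ge 0$. Hence $$\|x-y_k\|\le(1-C^{-2})^{k/2}\|x\|\qquad\text{for all }k\ge 0.$$
   Context: A family $(x_j)_{j\in J}$ in $H$ is a Parseval frame if $\sum_{j\in J}|\langle x,x_j\rangle|^2=\|x\|^2$ for all $x\in H$. Its analysis operator is $\Theta:H\to\ell_2(J)$, $\Theta x=(\langle x,x_j\rangle)_{j\in J}$. For $\lambda>0$, $\phi_\lambda:\mathbb{R}\to[-\lambda,\lambda]$ is given by $\phi_\lambda(t)=t$ if $|t|\le\lambda$ and $\phi_\lambda(t)=\mathrm{sign}(t)\lambda$ if $|t|>\lambda$, and $\Phi_\lambda((a_j)_{j\in J})=(\phi_\lambda(a_j))_{j\in J}$ on $\ell_2(J)$. The frame does $C$-stable $\lambda$-saturation recovery on $X\subseteq H$ if $\|u-v\|\le C\|\Phi_\lambda\Theta u-\Phi_\lambda\Theta v\|$ for all $u,v\in X$. $B_H$ is the closed unit ball of $H$. For $x,y\in H$ define $J_\lambda(x)=\{j\in J:|\langle x,x_j\rangle|\le\lambda\}$, $J_\lambda^+(x)=\{j\in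 J:\langle x,x_j\rangle>\lambda\}$, $J_\lambda^-(x)=\{j\in J:\langle x,x_j\rangle<-\lambda\}$, $J_\lambda^+(x,y)=\{j\in J_\lambda^+(x):\langle y,x_j\rangle<\lambda\}$, $J_\lambda^-(x,y)=\{j\in J_\lambda^-(x):\langle y,x_j\rangle>-\lambda\}$. The $\lambda$-saturated frame algorithm with parameters $\alpha_k,\beta_k\ge 0$ constructs $(y_k)_{k=0}^\infty$ by $y_0=0$ and $$y_{k+1}=y_k+\alpha_k\sum_{j\in J_\lambda(x)}\big(\langle x,x_j\rangle-\langle y_k,x_j\rangle\big)x_j+\beta_k\sum_{j\in J_\lambda^+(x,y_k)}\big(\lambda-\langle y_k,x_j\rangle\big)x_j+\beta_k\sum_{j\in J_\lambda^-(x,y_k)}\big(-\lambda-\langle y_k,x_j\rangle\big)x_j.$$ *)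

theory Defs
  imports "HOL-Analysis.Analysis"
begin

text \<open>
  The Hilbert space \<open>H\<close> is a type of class \<open>{real_inner, complete_space}\<close>. A family indexed by an
  arbitrary set \<open>J\<close> is a total function on the index type of which only the values on \<open>J\<close> matter.
  Sums over \<open>J\<close> are unconditional sums (\<open>has_sum\<close>, \<open>infsum\<close>).
\<close>

definition parseval_frame ::
    "'i set \<Rightarrow> ('i \<Rightarrow> 'a::{real_inner, complete_space}) \<Rightarrow> bool" where
  "parseval_frame J f \<longleftrightarrow> (\<forall>x. ((\<lambda>j. \<bar>x \<bullet> f j\<bar>\<^sup>2) has_sum (norm x)\<^sup>2) J)"

definition ell2 :: "'i set \<Rightarrow> ('i \<Rightarrow> real) set" where
  "ell2 J = {a. (\<lambda>j. \<bar>a j\<bar>\<^sup>2) summable_on J}"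

definition ell2_norm :: "'i set \<Rightarrow> ('i \<Rightarrow> real) \<Rightarrow> real" where
  "ell2_norm J a = sqrt (\<Sum>\<^sub>\<infinity>j\<in>J. \<bar>a j\<bar>\<^sup>2)"

definition analysis_op :: "('i \<Rightarrow> 'a::real_inner) \<Rightarrow> 'a \<Rightarrow> 'i \<Rightarrow> real" where
  "analysis_op f x = (\<lambda>j. x \<bullet> f j)"

definition sat :: "real \<Rightarrow> real \<Rightarrow> real" where
  "sat lam t = (if \<bar>t\<bar> \<le> lam then t else sgn t * lam)"

definition Sat :: "real \<Rightarrow> ('i \<Rightarrow> real) \<Rightarrow> 'i \<Rightarrow> real" where
  "Sat lam a = (\<lambda>j. sat lam (a j))"

definition stable_saturation_recovery ::
    "'i set \<Rightarrow> ('i \<Rightarrow> 'a::real_inner) \<Rightarrow> real \<Rightarrow> real \<Rightarrow> 'a set \<Rightarrow> bool" where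
  "stable_saturation_recovery J f C lam X \<longleftrightarrow>
     (\<forall>u\<in>X. \<forall>v\<in>X. norm (u - v) \<le>
        C * ell2_norm J (\<lambda>j. Sat lam (analysis_op f u) j - Sat lam (analysis_op f v) j))"

text \<open>
  The next lemmas show that, for a Parseval frame, \<open>ell2_norm\<close> above is only applied to
  square-summable families, so that the default value of \<open>infsum\<close> plays no role.
\<close>

lemma analysis_op_in_ell2: "parseval_frame J f \<Longrightarrow> analysis_op f x \<in> ell2 J"
  unfolding parseval_frame_def ell2_def analysis_op_def
  by (auto intro: has_sum_imp_summable)

lemma Sat_in_ell2:
  assumes "lam > 0" "a \<in> ell2 J"
  shows "Sat lam a \<in> ell2 J"
proof -
  have "\<bar>sat lam t\<bar> \<le> \<bar>t\<bar>" for t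
    using assms(1) by (auto simp: sat_def abs_mult sgn_if)
  then have "\<bar>Sat lam a j\<bar>\<^sup>2 \<le> \<bar>a j\<bar>\<^sup>2" for j
    unfolding Sat_def by (intro power_mono) auto
  then show ?thesis
    using assms(2) unfolding ell2_def
    by (auto intro: summable_on_comparison_test)
qed

lemma diff_in_ell2:
  assumes "a \<in> ell2 J" "b \<in> ell2 J"
  shows "(\<lambda>j. a j - b j) \<in> ell2 J"
proof -
  have "(\<lambda>j. 2 * \<bar>a j\<bar>\<^sup>2 + 2 * \<bar>b j\<bar>\<^sup>2) summable_on J"
    using assms unfolding ell2_def by (auto intro!: summable_on_add summable_on_cmult_right)
  moreover have "\<bar>a j - b j\<bar>\<^sup>2 \<le> 2 * \<bar>a j\<bar>\<^sup>2 + 2 * \<bar>b j\<bar>\<^sup>2" for j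
    using zero_le_power2[of "a j + b j"] by (simp add: power2_diff power2_sum)
  ultimately show ?thesis
    unfolding ell2_def mem_Collect_eq by (rule summable_on_comparison_test) auto
qed

definition J_unsat :: "'i set \<Rightarrow> ('i \<Rightarrow> 'a::real_inner) \<Rightarrow> real \<Rightarrow> 'a \<Rightarrow> 'i set" where
  "J_unsat J f lam x = {j\<in>J. \<bar>x \<bullet> f j\<bar> \<le> lam}"

definition J_pos :: "'i set \<Rightarrow> ('i \<Rightarrow> 'a::real_inner) \<Rightarrow> real \<Rightarrow> 'a \<Rightarrow> 'i set" where
  "J_pos J f lam x = {j\<in>J. x \<bullet> f j > lam}"

definition J_neg :: "'i set \<Rightarrow> ('i \<Rightarrow> 'a::real_inner) \<Rightarrow> real \<Rightarrow> 'a \<Rightarrow> 'i set" where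
  "J_neg J f lam x = {j\<in>J. x \<bullet> f j < - lam}"

definition J_pos2 :: "'i set \<Rightarrow> ('i \<Rightarrow> 'a::real_inner) \<Rightarrow> real \<Rightarrow> 'a \<Rightarrow> 'a \<Rightarrow> 'i set" where
  "J_pos2 J f lam x y = {j \<in> J_pos J f lam x. y \<bullet> f j < lam}"

definition J_neg2 :: "'i set \<Rightarrow> ('i \<Rightarrow> 'a::real_inner) \<Rightarrow> real \<Rightarrow> 'a \<Rightarrow> 'a \<Rightarrow> 'i set" where
  "J_neg2 J f lam x y = {j \<in> J_neg J f lam x. y \<bullet> f j > - lam}"

text \<open>
  For a Parseval frame and \<open>lam > 0\<close> the first sum below has square-summable coefficients, hence
  converges unconditionally, and the other two range over finite sets.
\<close>

primrec sat_frame_alg ::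
    "'i set \<Rightarrow> ('i \<Rightarrow> 'a::{real_inner, complete_space}) \<Rightarrow> real \<Rightarrow>
     (nat \<Rightarrow> real) \<Rightarrow> (nat \<Rightarrow> real) \<Rightarrow> 'a \<Rightarrow> nat \<Rightarrow> 'a" where
  "sat_frame_alg J f lam \<alpha> \<beta> x 0 = 0"
| "sat_frame_alg J f lam \<alpha> \<beta> x (Suc k) =
     (let y = sat_frame_alg J f lam \<alpha> \<beta> x k in
        y + \<alpha> k *\<^sub>R (\<Sum>\<^sub>\<infinity>j\<in>J_unsat J f lam x. (x \<bullet> f j - y \<bullet> f j) *\<^sub>R f j)
          + \<beta> k *\<^sub>R (\<Sum>\<^sub>\<infinity>j\<in>J_pos2 J f lam x y. (lam - y \<bullet> f j) *\<^sub>R f j)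
          + \<beta> k *\<^sub>R (\<Sum>\<^sub>\<infinity>j\<in>J_neg2 J f lam x y. (- lam - y \<bullet> f j) *\<^sub>R f j))"

end

theory Submission
  imports Defs
begin

text \<open>
  One step of the algorithm replaces \<open>y\<close> by \<open>y + (\<Sum>\<^sub>\<infinity>j\<in>J. c j *\<^sub>R f j)\<close>, where each coefficient \<open>c j\<close>
  lies between \<open>0\<close> and \<open>(x - y) \<bullet> f j\<close> and is at least as large in absolute value as
  \<open>sat lam (x \<bullet> f j) - sat lam (y \<bullet> f j)\<close>. Since the synthesis operator of a Parseval frame is a
  contraction, expanding the square gives
  \<open>(norm (x - y'))\<^sup>2 \<le> (norm (x - y))\<^sup>2 - 2 * (\<Sum>\<^sub>\<infinity>j\<in>J. c j * ((x - y) \<bullet> f j)) + (\<Sum>\<^sub>\<infinity>j\<in>J. (c j)\<^sup>2)\<close>,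
  which is at most \<open>(norm (x - y))\<^sup>2 - (\<Sum>\<^sub>\<infinity>j\<in>J. (c j)\<^sup>2)\<close>; stable recovery bounds the last sum from
  below by \<open>(norm (x - y))\<^sup>2 / C\<^sup>2\<close>. The iterates stay in the ball of radius \<open>2 * norm x\<close> because their
  distance to \<open>x\<close> never increases.
\<close>

lemma parseval_frame_has_sum:
  "parseval_frame J f \<Longrightarrow> ((\<lambda>j. (x \<bullet> f j)\<^sup>2) has_sum (norm x)\<^sup>2) J"
  by (simp add: parseval_frame_def)

text \<open>With \<open>s\<close> the finite sum, \<open>s \<bullet> s\<close> pairs the
  coefficients \<open>c j\<close> with the analysis coefficients \<open>s \<bullet> f j\<close>.
  Cauchy-Schwarz and the Parseval identity for \<open>s\<close>, truncated to \<open>F\<close>,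
  bound its square by the sum of squares times the squared norm of \<open>s\<close>; one factor then
  cancels.\<close>

lemma norm_finite_synthesis_le:
  assumes "parseval_frame J f" and F: "finite F" "F \<subseteq> J"
  shows "(norm (\<Sum>j\<in>F. c j *\<^sub>R f j))\<^sup>2 \<le> (\<Sum>j\<in>F. (c j)\<^sup>2)"
proof -
  define s where "s = (\<Sum>j\<in>F. c j *\<^sub>R f j)"
  have "(norm s)\<^sup>2 = (\<Sum>j\<in>F. c j * (s \<bullet> f j))"
    by (subst power2_norm_eq_inner) (simp add: s_def inner_sum_right)
  then have "((norm s)\<^sup>2)\<^sup>2 \<le> (\<Sum>j\<in>F. (c j)\<^sup>2) * (\<Sum>j\<in>F. (s \<bullet> f j)\<^sup>2)"
    by (simp only: Cauchy_Schwarz_ineq_sum)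
  also have "\<dots> \<le> (\<Sum>j\<in>F. (c j)\<^sup>2) * (norm s)\<^sup>2"
    using finite_sum_le_has_sum[OF parseval_frame_has_sum[OF assms(1)] F]
    by (intro mult_left_mono sum_nonneg) auto
  finally have "(norm s)\<^sup>2 * (norm s)\<^sup>2 \<le> (\<Sum>j\<in>F. (c j)\<^sup>2) * (norm s)\<^sup>2"
    by (simp only: power2_eq_square)
  moreover have "0 \<le> (\<Sum>j\<in>F. (c j)\<^sup>2)"
    by (simp add: sum_nonneg)
  ultimately have "(norm s)\<^sup>2 \<le> (\<Sum>j\<in>F. (c j)\<^sup>2)"
    by (cases "norm s = 0") (simp_all only: mult_le_cancel_right zero_less_power2 zero_power2, auto)
  then show ?thesis
    by (simp add: s_def)
qed

text \<open>By the finite bound, small tails of the squared coefficients force small tails of the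
  vector sums, so the net of partial sums is Cauchy. Subsets \<open>B\<close> are allowed because
  the algorithm sums over three of them.\<close>

lemma summable_on_synthesis:
  fixes f :: "'i \<Rightarrow> 'a::{real_inner, complete_space}"
  assumes "parseval_frame J f" and "B \<subseteq> J" and "(\<lambda>j. (c j)\<^sup>2) summable_on B"
  shows "(\<lambda>j. c j *\<^sub>R f j) summable_on B"
proof -
  define g where "g = (\<lambda>j. c j *\<^sub>R f j)"
  obtain S where S: "((\<lambda>j. (c j)\<^sup>2) has_sum S) B"
    using assms(3) by (auto simp: summable_on_def)
  have "cauchy_filter (filtermap (sum g) (finite_subsets_at_top B))"
    unfolding cauchy_filter_metric_filtermap
  proof (intro allI impI)
    fix e :: real assume "e > 0"
    \<comment> \<open>Beyond \<open>F0\<close> less than \<open>(e/2)\<^sup>2\<close> of the total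
      \<open>S\<close> is left, so every larger partial sum stays within \<open>e/2\<close> of the
      one over \<open>F0\<close>, and two of them within \<open>e\<close> of each other.\<close>
    then have "S - (e/2)\<^sup>2 < S" by simp
    with S have "\<forall>\<^sub>F F in finite_subsets_at_top B. S - (e/2)\<^sup>2 < (\<Sum>j\<in>F. (c j)\<^sup>2)"
      unfolding has_sum_def by (rule order_tendstoD(1))
    then obtain F0 where F0: "finite F0" "F0 \<subseteq> B" "S - (e/2)\<^sup>2 < (\<Sum>j\<in>F0. (c j)\<^sup>2)"
      unfolding eventually_finite_subsets_at_top by blast
    have near: "dist (sum g F) (sum g F0) < e / 2" if F: "finite F" "F0 \<subseteq> F" "F \<subseteq> B" for F
    proof -
      have "(norm (sum g (F - F0)))\<^sup>2 \<le> (\<Sum>j\<in>F - F0. (c j)\<^sup>2)"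
        unfolding g_def using F assms(2) by (intro norm_finite_synthesis_le[OF assms(1)]) auto
      also have "\<dots> = (\<Sum>j\<in>F. (c j)\<^sup>2) - (\<Sum>j\<in>F0. (c j)\<^sup>2)"
        using F by (simp add: sum_diff)
      also have "\<dots> < (e/2)\<^sup>2"
        using F0(3) finite_sum_le_has_sum[OF S F(1,3)] by simp
      finally have "norm (sum g (F - F0)) < e / 2"
        by (rule power2_less_imp_less) (use \<open>e > 0\<close> in simp)
      then show ?thesis
        using F by (simp add: dist_norm sum_diff)
    qed
    show "\<exists>P. eventually P (finite_subsets_at_top B) \<and>
            (\<forall>F G. P F \<and> P G \<longrightarrow> dist (sum g F) (sum g G) < e)"
    proof (intro exI conjI allI impI)
      show "eventually (\<lambda>F. finite F \<and> F0 \<subseteq> F \<and> F \<subseteq> B) (finite_subsets_at_top B)"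
        using F0 by (auto simp: eventually_finite_subsets_at_top)
      fix F G assume "(finite F \<and> F0 \<subseteq> F \<and> F \<subseteq> B) \<and> (finite G \<and> F0 \<subseteq> G \<and> G \<subseteq> B)"
      then show "dist (sum g F) (sum g G) < e"
        using near[of F] near[of G] by (metis dist_triangle_half_l)
    qed
  qed
  then have "convergent_filter (filtermap (sum g) (finite_subsets_at_top B))"
    by (rule cauchy_filter_convergent)
  then show ?thesis
    by (auto simp: convergent_filter.simps summable_on_def has_sum_def filterlim_def g_def)
qed

lemma norm_synthesis_le:
  fixes f :: "'i \<Rightarrow> 'a::{real_inner, complete_space}"
  assumes "parseval_frame J f" and "(\<lambda>j. (c j)\<^sup>2) summable_on J"
  shows "(norm (\<Sum>\<^sub>\<infinity>j\<in>J. c j *\<^sub>R f j))\<^sup>2 \<le> (\<Sum>\<^sub>\<infinity>j\<in>J. (c j)\<^sup>2)"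
proof (rule tendsto_le)
  show "((\<lambda>F. (norm (\<Sum>j\<in>F. c j *\<^sub>R f j))\<^sup>2) \<longlongrightarrow> (norm (\<Sum>\<^sub>\<infinity>j\<in>J. c j *\<^sub>R f j))\<^sup>2)
      (finite_subsets_at_top J)"
    using has_sum_infsum[OF summable_on_synthesis[OF assms(1) subset_refl assms(2)]]
    unfolding has_sum_def by (intro tendsto_intros)
  show "((\<lambda>F. \<Sum>j\<in>F. (c j)\<^sup>2) \<longlongrightarrow> (\<Sum>\<^sub>\<infinity>j\<in>J. (c j)\<^sup>2)) (finite_subsets_at_top J)"
    using has_sum_infsum[OF assms(2)] unfolding has_sum_def .
  show "\<forall>\<^sub>F F in finite_subsets_at_top J. (norm (\<Sum>j\<in>F. c j *\<^sub>R f j))\<^sup>2 \<le> (\<Sum>j\<in>F. (c j)\<^sup>2)"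
    using norm_finite_synthesis_le[OF assms(1)]
    by (intro eventually_finite_subsets_at_top_weakI) auto
qed simp

text \<open>The hypothesis \<open>between\<close> says, without cases on signs, that
  \<open>c j\<close> lies between 0 and \<open>d \<bullet> f j\<close>. The cross term then removes
  at least twice the sum of squares, and contractivity of synthesis gives back at most one of the
  two.\<close>

lemma norm_diff_synthesis_le:
  fixes f :: "'i \<Rightarrow> 'a::{real_inner, complete_space}"
  assumes "parseval_frame J f"
    and between: "\<And>j. j \<in> J \<Longrightarrow> (c j)\<^sup>2 \<le> c j * (d \<bullet> f j)"
  shows "(\<lambda>j. (c j)\<^sup>2) summable_on J"
    and "(norm (d - (\<Sum>\<^sub>\<infinity>j\<in>J. c j *\<^sub>R f j)))\<^sup>2 \<le> (norm d)\<^sup>2 - (\<Sum>\<^sub>\<infinity>j\<in>J. (c j)\<^sup>2)"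
proof -
  have "(c j)\<^sup>2 \<le> (d \<bullet> f j)\<^sup>2" if "j \<in> J" for j
    \<comment> \<open>Adding \<open>2 * (c j)\<^sup>2 \<le> 2 * c j * (d \<bullet> f j)\<close> to
      the expanded square leaves exactly the claim.\<close>
    using between[OF that] zero_le_power2[of "c j - d \<bullet> f j"]
    by (simp add: power2_diff)
  then show c: "(\<lambda>j. (c j)\<^sup>2) summable_on J"
    using has_sum_imp_summable[OF parseval_frame_has_sum[OF assms(1), of d]]
    by (auto intro: summable_on_comparison_test)
  define s where "s = (\<Sum>\<^sub>\<infinity>j\<in>J. c j *\<^sub>R f j)"
  have "((\<lambda>j. d \<bullet> (c j *\<^sub>R f j)) has_sum d \<bullet> s) J"
    unfolding s_def using has_sum_infsum[OF summable_on_synthesis[OF assms(1) subset_refl c]]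
    by (rule has_sum_bounded_linear[OF bounded_linear_inner_right])
  then have "(\<Sum>\<^sub>\<infinity>j\<in>J. (c j)\<^sup>2) \<le> d \<bullet> s"
    using between by (intro has_sum_mono[OF has_sum_infsum[OF c]]) auto
  moreover have "(norm (d - s))\<^sup>2 = (norm d)\<^sup>2 - 2 * (d \<bullet> s) + (norm s)\<^sup>2"
    by (simp add: power2_norm_eq_inner inner_diff inner_commute)
  ultimately show "(norm (d - s))\<^sup>2 \<le> (norm d)\<^sup>2 - (\<Sum>\<^sub>\<infinity>j\<in>J. (c j)\<^sup>2)"
    using norm_synthesis_le[OF assms(1) c] by (simp add: s_def)
qed

text \<open>With \<open>s\<close> and \<open>t\<close> standing for the frame coefficients of the
  target and of the current iterate, this merges the summands of all three sums of the algorithm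
  into one coefficient on \<open>J\<close>, extended by 0.\<close>

definition step_coeff :: "real \<Rightarrow> real \<Rightarrow> real \<Rightarrow> real" where
  "step_coeff lam s t =
     (if \<bar>s\<bar> \<le> lam then s - t
      else if s > lam \<and> t < lam then lam - t
      else if s < - lam \<and> t > - lam then - lam - t
      else 0)"

lemma step_coeff_between:
  assumes "lam > 0"
  shows "(step_coeff lam s t)\<^sup>2 \<le> step_coeff lam s t * (s - t)"
  unfolding power2_eq_square
proof (cases "step_coeff lam s t \<ge> 0")
  case True
  \<comment> \<open>The first alternative is needed when \<open>s\<close> and \<open>t\<close> both
    lie at or above \<open>lam\<close>: the coefficient is 0, while \<open>s - t\<close> may be
    negative.\<close>
  then have "step_coeff lam s t = 0 \<or> step_coeff lam s t \<le> s - t"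
    using assms by (auto simp: step_coeff_def split: if_splits)
  with True show "step_coeff lam s t * step_coeff lam s t \<le> step_coeff lam s t * (s - t)"
    by (auto intro: mult_left_mono)
next
  case False
  then have "s - t \<le> step_coeff lam s t"
    using assms by (auto simp: step_coeff_def split: if_splits)
  with False show "step_coeff lam s t * step_coeff lam s t \<le> step_coeff lam s t * (s - t)"
    by (auto intro: mult_left_mono_neg)
qed

lemma sat_eq_max_min: "lam > 0 \<Longrightarrow> sat lam t = max (- lam) (min lam t)"
  by (auto simp: sat_def sgn_if)

text \<open>Clamping fixes an unsaturated \<open>s\<close> and does not increase its distance to
  \<open>t\<close>. For \<open>s\<close> beyond a threshold, the step moves \<open>t\<close> to that
  threshold, at least as far as from the clamped \<open>t\<close>; if \<open>t\<close> has already
  reached it, both clamp to the same value.\<close>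

lemma abs_sat_diff_le_step_coeff:
  assumes "lam > 0"
  shows "\<bar>sat lam s - sat lam t\<bar> \<le> \<bar>step_coeff lam s t\<bar>"
  using assms by (auto simp: sat_eq_max_min step_coeff_def)

lemma sat_frame_alg_Suc:
  fixes f :: "'i \<Rightarrow> 'a::{real_inner, complete_space}" and x :: 'a
  assumes frame: "parseval_frame J f" and lam: "lam > 0"
    and "\<alpha> k = 1" "\<beta> k = 1"
  defines "y \<equiv> sat_frame_alg J f lam \<alpha> \<beta> x"
  shows "y (Suc k) = y k + (\<Sum>\<^sub>\<infinity>j\<in>J. step_coeff lam (x \<bullet> f j) (y k \<bullet> f j) *\<^sub>R f j)"
proof -
  define c where "c j = step_coeff lam (x \<bullet> f j) (y k \<bullet> f j)" for j
  define A where "A = J_unsat J f lam x"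
  define P where "P = J_pos2 J f lam x (y k)"
  define N where "N = J_neg2 J f lam x (y k)"
  note sets = A_def P_def N_def J_unsat_def J_pos2_def J_neg2_def J_pos_def J_neg_def
  have c: "(\<lambda>j. (c j)\<^sup>2) summable_on J"
    by (rule norm_diff_synthesis_le(1)[OF frame, of _ "x - y k"])
       (simp add: c_def inner_diff_left step_coeff_between[OF lam])
  have summ: "(\<lambda>j. c j *\<^sub>R f j) summable_on B" if "B \<subseteq> J" for B
    using summable_on_synthesis[OF frame that] summable_on_subset_banach[OF c that] .
  have "(\<Sum>\<^sub>\<infinity>j\<in>J. c j *\<^sub>R f j) = (\<Sum>\<^sub>\<infinity>j\<in>A \<union> P \<union> N. c j *\<^sub>R f j)"
    \<comment> \<open>The indices left over are those where \<open>x\<close> is saturated and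
      \<open>y k\<close> has reached the same threshold, so the coefficient is 0.\<close>
    by (rule infsum_cong_neutral) (auto simp: sets c_def step_coeff_def)
  also have "\<dots> = (\<Sum>\<^sub>\<infinity>j\<in>A. c j *\<^sub>R f j) + (\<Sum>\<^sub>\<infinity>j\<in>P. c j *\<^sub>R f j) + (\<Sum>\<^sub>\<infinity>j\<in>N. c j *\<^sub>R f j)"
  proof -
    have "A \<subseteq> J" "P \<subseteq> J" "N \<subseteq> J" "A \<inter> P = {}" "(A \<union> P) \<inter> N = {}"
      using lam by (auto simp: sets)
    then show ?thesis
      by (simp add: infsum_Un_disjoint summ)
  qed
  also have "(\<Sum>\<^sub>\<infinity>j\<in>A. c j *\<^sub>R f j) = (\<Sum>\<^sub>\<infinity>j\<in>A. (x \<bullet> f j - y k \<bullet> f j) *\<^sub>R f j)"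
    by (rule infsum_cong) (auto simp: sets c_def step_coeff_def)
  also have "(\<Sum>\<^sub>\<infinity>j\<in>P. c j *\<^sub>R f j) = (\<Sum>\<^sub>\<infinity>j\<in>P. (lam - y k \<bullet> f j) *\<^sub>R f j)"
    by (rule infsum_cong) (auto simp: sets c_def step_coeff_def)
  also have "(\<Sum>\<^sub>\<infinity>j\<in>N. c j *\<^sub>R f j) = (\<Sum>\<^sub>\<infinity>j\<in>N. (- lam - y k \<bullet> f j) *\<^sub>R f j)"
    using lam by (intro infsum_cong) (auto simp: sets c_def step_coeff_def)
  finally show ?thesis
    using assms(3,4) by (simp add: c_def[abs_def] A_def P_def N_def y_def Let_def add.assoc)
qed

lemma ell2_norm_Sat_diff_le:
  assumes "lam > 0" and "(\<lambda>j. (step_coeff lam (u \<bullet> f j) (v \<bullet> f j))\<^sup>2) summable_on J"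
  shows "(ell2_norm J (\<lambda>j. Sat lam (analysis_op f u) j - Sat lam (analysis_op f v) j))\<^sup>2
       \<le> (\<Sum>\<^sub>\<infinity>j\<in>J. (step_coeff lam (u \<bullet> f j) (v \<bullet> f j))\<^sup>2)"
proof -
  have le: "\<bar>Sat lam (analysis_op f u) j - Sat lam (analysis_op f v) j\<bar>\<^sup>2
      \<le> (step_coeff lam (u \<bullet> f j) (v \<bullet> f j))\<^sup>2" for j
    using abs_sat_diff_le_step_coeff[OF assms(1)]
    by (simp add: Sat_def analysis_op_def abs_le_square_iff)
  then have "(\<lambda>j. \<bar>Sat lam (analysis_op f u) j - Sat lam (analysis_op f v) j\<bar>\<^sup>2) summable_on J"
    by (intro summable_on_comparison_test[OF assms(2)]) auto
  then show ?thesis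
    unfolding ell2_norm_def using le assms(2)
    by (subst real_sqrt_pow2) (auto intro: infsum_nonneg infsum_mono)
qed

theorem theorem5p3:
  fixes J :: "'i set"
    and f :: "'i \<Rightarrow> 'a::{real_inner, complete_space}"
    and lam C :: real
    and x :: 'a
    and \<alpha> \<beta> :: "nat \<Rightarrow> real"
    and y :: "nat \<Rightarrow> 'a"
  assumes "parseval_frame J f"
    and "lam > 0"
    and "C > 0"
    and "stable_saturation_recovery J f C lam ((\<lambda>u. (2 * norm x) *\<^sub>R u) ` cball 0 1)"
    and "\<And>k. \<alpha> k = 1" and "\<And>k. \<beta> k = 1"
    and "y = sat_frame_alg J f lam \<alpha> \<beta> x"
  shows "(\<forall>k. (norm (x - y (Suc k)))\<^sup>2 \<le> (1 - 1 / C\<^sup>2) * (norm (x - y k))\<^sup>2) \<and>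
         (\<forall>k. norm (x - y k) \<le> sqrt (1 - 1 / C\<^sup>2) ^ k * norm x)"
proof -
  define c where "c k j = step_coeff lam (x \<bullet> f j) (y k \<bullet> f j)" for k j
  have between: "(c k j)\<^sup>2 \<le> c k j * ((x - y k) \<bullet> f j)" for k j
    by (simp add: c_def inner_diff_left step_coeff_between[OF assms(2)])
  have decrease: "(norm (x - y (Suc k)))\<^sup>2 \<le> (norm (x - y k))\<^sup>2 - (\<Sum>\<^sub>\<infinity>j\<in>J. (c k j)\<^sup>2)" for k
    using norm_diff_synthesis_le(2)[OF assms(1) between, of k]
      sat_frame_alg_Suc[OF assms(1,2), of \<alpha> k \<beta> x] assms(5-7)
    by (simp add: c_def diff_diff_eq)
  have dist_le: "norm (x - y k) \<le> norm x" for k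
  proof (induction k)
    case 0
    then show ?case by (simp add: assms(7))
  next
    case (Suc k)
    have "(norm (x - y (Suc k)))\<^sup>2 \<le> (norm (x - y k))\<^sup>2"
      using decrease[of k] infsum_nonneg[of J "\<lambda>j. (c k j)\<^sup>2", OF zero_le_power2] by linarith
    then have "norm (x - y (Suc k)) \<le> norm (x - y k)"
      by (rule power2_le_imp_le) simp
    with Suc show ?case by simp
  qed
  have recovery: "norm (u - v) \<le>
      C * ell2_norm J (\<lambda>j. Sat lam (analysis_op f u) j - Sat lam (analysis_op f v) j)"
    if "norm u \<le> 2 * norm x" "norm v \<le> 2 * norm x" for u v
  \<comment> \<open>The witness in the unit ball is obtained by dividing by
    \<open>2 * norm x\<close>. For \<open>x = 0\<close> both vectors vanish and the bound is
    trivial.\<close>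
  proof (cases "x = 0")
    case True
    with that show ?thesis by (simp add: assms(3) ell2_norm_def)
  next
    case False
    have "w \<in> (\<lambda>u. (2 * norm x) *\<^sub>R u) ` cball 0 1" if "norm w \<le> 2 * norm x" for w
      using that False by (intro image_eqI[of _ _ "(1 / (2 * norm x)) *\<^sub>R w"]) (auto simp: field_simps)
    with that show ?thesis
      using assms(4) unfolding stable_saturation_recovery_def by blast
  qed
  have contract: "(norm (x - y (Suc k)))\<^sup>2 \<le> (1 - 1 / C\<^sup>2) * (norm (x - y k))\<^sup>2" for k
  proof -
    have "norm (y k) \<le> 2 * norm x"
      using dist_le[of k] norm_triangle_ineq4[of x "x - y k"] by simp
    then have "norm (x - y k) \<le>
        C * ell2_norm J (\<lambda>j. Sat lam (analysis_op f x) j - Sat lam (analysis_op f (y k)) j)"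
      by (intro recovery) auto
    then have "(norm (x - y k))\<^sup>2 \<le>
        C\<^sup>2 * (ell2_norm J (\<lambda>j. Sat lam (analysis_op f x) j - Sat lam (analysis_op f (y k)) j))\<^sup>2"
      by (metis norm_ge_zero power_mono power_mult_distrib)
    also have "\<dots> \<le> C\<^sup>2 * (\<Sum>\<^sub>\<infinity>j\<in>J. (c k j)\<^sup>2)"
      using ell2_norm_Sat_diff_le[OF assms(2), of x f "y k" J]
        norm_diff_synthesis_le(1)[OF assms(1) between, of k]
      by (intro mult_left_mono) (auto simp: c_def)
    finally have "(norm (x - y k))\<^sup>2 / C\<^sup>2 \<le> (\<Sum>\<^sub>\<infinity>j\<in>J. (c k j)\<^sup>2)"
      using assms(3) by (simp add: pos_divide_le_eq mult.commute)
    with decrease[of k] show ?thesis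
      by (simp add: algebra_simps)
  qed
  have "norm (x - y k) \<le> sqrt (1 - 1 / C\<^sup>2) ^ k * norm x" for k
  proof (cases "x = 0")
    case True
    with dist_le[of k] show ?thesis by simp
  next
    case False
    have "y 0 = 0"
      by (simp add: assms(7))
    \<comment> \<open>The sign of the rate comes from the contraction itself: at the first step it
      bounds a square by the rate times \<open>(norm x)\<^sup>2\<close>, which is positive here. For
      \<open>x = 0\<close> the rate may be negative, but both sides of the claim are then 0.\<close>
    then have "0 \<le> (1 - 1 / C\<^sup>2) * (norm x)\<^sup>2"
      using order_trans[OF zero_le_power2 contract[of 0]] by simp
    with False have q: "0 \<le> 1 - 1 / C\<^sup>2"
      by (simp add: zero_le_mult_iff)
    show ?thesis
    proof (induction k)
      case 0
      then show ?case by (simp add: assms(7))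
    next
      case (Suc k)
      have "norm (x - y (Suc k)) \<le> sqrt (1 - 1 / C\<^sup>2) * norm (x - y k)"
        using real_sqrt_le_mono[OF contract[of k]] by (simp add: real_sqrt_mult)
      also have "\<dots> \<le> sqrt (1 - 1 / C\<^sup>2) * (sqrt (1 - 1 / C\<^sup>2) ^ k * norm x)"
        using Suc q by (intro mult_left_mono) auto
      finally show ?case by (simp add: mult.assoc)
    qed
  qed
  with contract show ?thesis by blast
qed

end
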